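(* Let $\Omega$ be a completely regular Hausdorff topological space and let $C(\Omega)$ be the space of all real-valued continuous functions on $\Omega$, equipped with the compact-open topology. A subset of $C(\Omega)$ is a closed sublattice of $C(\Omega)$ if and only if it is of the form $\mathcal M_\perp$, where $\mathcal M$ is a collection of functionals of the form $\delta_s-\alpha\delta_t$ with $s,t\in\Omega$ and $\alpha\ge 0$.
   Context: A sublattice of $C(\Omega)$ is a linear subspace closed under the pointwise operations $\vee$ and $\wedge$. "Closed" refers to the compact-open topology. For $t\in\Omega$, $\delta_t(f)=f(t)$ for $f\in C(\Omega)$. For a set $\mathcal M$ of linear functionals on $C(\Omega)$, $\mathcal M_\perp=\{f\in C(\Omega) : \mu(f)=0 \text{ for all } \mu\in\mathcal M\}$. *)

theory Defs
  imports "HOL-Analysis.Analysis"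
begin

text \<open>Functions on the space X are represented by functions on the ambient type that take the
  value \<^term>\<open>undefined\<close> off \<^term>\<open>topspace X\<close>, so that equality in C(X) is equality on X.
  The pointwise operations below are accordingly restricted to \<^term>\<open>topspace X\<close>.\<close>

definition cont_fun :: "'a topology \<Rightarrow> ('a \<Rightarrow> real) set" where
  "cont_fun X = {f \<in> extensional (topspace X). continuous_map X euclideanreal f}"

text \<open>The subbasic set for \<^term>\<open>K = {}\<close> is all of C(X), hence so is the topspace.\<close>

definition compact_open_topology :: "'a topology \<Rightarrow> ('a \<Rightarrow> real) topology" where
  "compact_open_topology X =
     topology_generated_by {{f \<in> cont_fun X. f ` K \<subseteq> U} | K U. compactin X K \<and> open U}"

definition linear_subspace :: "'a topology \<Rightarrow> ('a \<Rightarrow> real) set \<Rightarrow> bool" where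
  "linear_subspace X L \<longleftrightarrow>
     L \<subseteq> cont_fun X \<and>
     (\<lambda>x\<in>topspace X. 0) \<in> L \<and>
     (\<forall>f\<in>L. \<forall>g\<in>L. (\<lambda>x\<in>topspace X. f x + g x) \<in> L) \<and>
     (\<forall>c. \<forall>f\<in>L. (\<lambda>x\<in>topspace X. c * f x) \<in> L)"

definition sublattice :: "'a topology \<Rightarrow> ('a \<Rightarrow> real) set \<Rightarrow> bool" where
  "sublattice X L \<longleftrightarrow>
     linear_subspace X L \<and>
     (\<forall>f\<in>L. \<forall>g\<in>L. (\<lambda>x\<in>topspace X. max (f x) (g x)) \<in> L) \<and>
     (\<forall>f\<in>L. \<forall>g\<in>L. (\<lambda>x\<in>topspace X. min (f x) (g x)) \<in> L)"

definition closed_sublattice :: "'a topology \<Rightarrow> ('a \<Rightarrow> real) set \<Rightarrow> bool" where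
  "closed_sublattice X L \<longleftrightarrow> sublattice X L \<and> closedin (compact_open_topology X) L"

definition delta :: "'a \<Rightarrow> ('a \<Rightarrow> real) \<Rightarrow> real" where
  "delta t f = f t"

text \<open>Functionals are total on the function type; only their values on C(X) matter here.\<close>

definition annihilator :: "'a topology \<Rightarrow> (('a \<Rightarrow> real) \<Rightarrow> real) set \<Rightarrow> ('a \<Rightarrow> real) set" where
  "annihilator X M = {f \<in> cont_fun X. \<forall>\<mu>\<in>M. \<mu> f = 0}"

end

theory Submission
  imports Defs
begin

text \<open>
  Each functional \<open>\<delta>\<^sub>s - \<alpha>\<delta>\<^sub>t\<close> is continuous for the compact-open topology, and its kernel is a
  sublattice because multiplication by \<open>\<alpha> \<ge> 0\<close> commutes with maxima and minima; hence
  annihilators of families of such functionals are closed sublattices.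

  Conversely, let \<open>L\<close> be a closed sublattice and let \<open>M\<close> consist of all functionals
  \<open>\<delta>\<^sub>s - \<alpha>\<delta>\<^sub>t\<close> with \<open>\<alpha> \<ge> 0\<close> that vanish on \<open>L\<close>.  Restricting \<open>L\<close> to two points \<open>s, t\<close> gives a vector
  sublattice of the plane.  If it is a proper subspace, it lies on a coordinate axis or on a line
  of positive slope, that is, it is cut out by members of \<open>M\<close>.  So every \<open>f\<close> annihilated by \<open>M\<close>
  agrees at any two given points with some member of \<open>L\<close> (\<open>two_point_interpolation\<close>).  The
  lattice form of the Stone--Weierstrass argument (\<open>uniform_approximation\<close>) then approximates \<open>f\<close>
  by members of \<open>L\<close> uniformly on each compact set, and since \<open>L\<close> is closed in the compact-open
  topology (\<open>compact_open_uniform_nbhd\<close>), \<open>f\<close> belongs to \<open>L\<close>.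
\<close>

section \<open>The compact-open topology\<close>

lemma openin_compact_open_topology_subbasic:
  assumes "compactin X K" "open U"
  shows "openin (compact_open_topology X) {f \<in> cont_fun X. f ` K \<subseteq> U}"
  unfolding compact_open_topology_def
  by (rule topology_generated_by_Basis) (use assms in blast)

lemma topspace_compact_open_topology:
  "topspace (compact_open_topology X) = cont_fun X"
proof
  show "topspace (compact_open_topology X) \<subseteq> cont_fun X"
    by (auto simp: compact_open_topology_def topology_generated_by_topspace)
  have "openin (compact_open_topology X) {f \<in> cont_fun X. f ` {} \<subseteq> UNIV}"
    by (rule openin_compact_open_topology_subbasic) auto
  then show "cont_fun X \<subseteq> topspace (compact_open_topology X)"
    using openin_subset by fastforce
qed

lemma continuous_map_delta:
  assumes "t \<in> topspace X"
  shows "continuous_map (compact_open_topology X) euclideanreal (delta t)"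
proof -
  have "openin (compact_open_topology X) {f \<in> cont_fun X. delta t f \<in> U}" if "open U" for U
    using openin_compact_open_topology_subbasic[of X "{t}" U] assms that
    by (simp add: delta_def)
  then show ?thesis
    by (auto simp: continuous_map topspace_compact_open_topology open_openin[symmetric])
qed

text \<open>The compact-open topology is no finer than uniform convergence on compact sets.\<close>

lemma compact_open_uniform_nbhd:
  assumes "openin (compact_open_topology X) W" "f \<in> W"
  shows "\<exists>K e. compactin X K \<and> e > 0 \<and>
           (\<forall>g\<in>cont_fun X. (\<forall>x\<in>K. \<bar>g x - f x\<bar> < e) \<longrightarrow> g \<in> W)"
proof -
  have "generate_topology_on {{f \<in> cont_fun X. f ` K \<subseteq> U} | K U. compactin X K \<and> open U} W"
    using assms(1) unfolding compact_open_topology_def openin_topology_generated_by_iff .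
  then show ?thesis
    using \<open>f \<in> W\<close>
  proof induction
    case Empty
    then show ?case by simp
  next
    case (Int A B)
    then obtain K e K' e' where
      A: "compactin X K" "e > 0" "\<forall>g\<in>cont_fun X. (\<forall>x\<in>K. \<bar>g x - f x\<bar> < e) \<longrightarrow> g \<in> A" and
      B: "compactin X K'" "e' > 0" "\<forall>g\<in>cont_fun X. (\<forall>x\<in>K'. \<bar>g x - f x\<bar> < e') \<longrightarrow> g \<in> B"
      using Int.IH Int.prems by blast
    show ?case
      using A B by (intro exI[of _ "K \<union> K'"] exI[of _ "min e e'"]) (auto simp: compactin_Un)
  next
    case (UN \<A>)
    then obtain A where "A \<in> \<A>" "f \<in> A" by blast
    with UN.IH[OF this] show ?case by blast
  next
    case (Basis S)
    then obtain K U where S: "S = {f \<in> cont_fun X. f ` K \<subseteq> U}" and K: "compactin X K"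
      and U: "open U" by blast
    have f: "f ` K \<subseteq> U" "continuous_map X euclideanreal f"
      using Basis S by (auto simp: cont_fun_def)
    have "compact (f ` K)"
      using image_compactin[OF K f(2)] by simp
    then obtain e where e: "e > 0" "(\<Union>y\<in>f ` K. ball y e) \<subseteq> U"
      by (rule compact_subset_open_imp_ball_epsilon_subset[OF _ U f(1)])
    have "g \<in> S" if g: "g \<in> cont_fun X" "\<forall>x\<in>K. \<bar>g x - f x\<bar> < e" for g
    proof -
      have "g x \<in> ball (f x) e" if "x \<in> K" for x
        using g(2) that by (simp add: dist_real_def abs_minus_commute)
      then show ?thesis using e(2) g(1) S by blast
    qed
    with K e(1) show ?case by blast
  qed
qed

section \<open>Annihilators are closed sublattices\<close>

lemma sublatticeD:
  assumes "sublattice X L"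
  shows "L \<subseteq> cont_fun X"
    and "(\<lambda>x\<in>topspace X. 0) \<in> L"
    and "f \<in> L \<Longrightarrow> g \<in> L \<Longrightarrow> (\<lambda>x\<in>topspace X. f x + g x) \<in> L"
    and "f \<in> L \<Longrightarrow> (\<lambda>x\<in>topspace X. c * f x) \<in> L"
    and "f \<in> L \<Longrightarrow> g \<in> L \<Longrightarrow> (\<lambda>x\<in>topspace X. max (f x) (g x)) \<in> L"
  using assms unfolding sublattice_def linear_subspace_def by simp_all

lemma closed_sublattice_annihilator:
  assumes M: "M \<subseteq> {(\<lambda>f. delta s f - \<alpha> * delta t f) | s t \<alpha>.
                s \<in> topspace X \<and> t \<in> topspace X \<and> \<alpha> \<ge> 0}"
  shows "closed_sublattice X (annihilator X M)"
proof -
  have mu: "\<exists>s\<in>topspace X. \<exists>t\<in>topspace X. \<exists>\<alpha>\<ge>0. \<mu> = (\<lambda>f. f s - \<alpha> * f t)" if "\<mu> \<in> M" for \<mu>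
    using M that unfolding delta_def by blast
  \<comment> \<open>Sums, scalar multiples, maxima and minima are all instances of a pointwise operation \<open>F\<close>
      that preserves continuity and commutes with multiplication by nonnegative scalars.\<close>
  have closed: "(\<lambda>x\<in>topspace X. F (f x) (g x)) \<in> annihilator X M"
    if fg: "f \<in> annihilator X M" "g \<in> annihilator X M"
      and F: "\<And>\<alpha> u v. \<alpha> \<ge> 0 \<Longrightarrow> F (\<alpha> * u) (\<alpha> * v) = \<alpha> * F u v"
      and cont: "continuous_map X euclideanreal (\<lambda>x. F (f x) (g x))"
    for F :: "real \<Rightarrow> real \<Rightarrow> real" and f g
  proof -
    have "\<mu> (\<lambda>x\<in>topspace X. F (f x) (g x)) = 0" if \<mu>M: "\<mu> \<in> M" for \<mu>
    proof -
      obtain s t \<alpha> where st: "s \<in> topspace X" "t \<in> topspace X" "\<alpha> \<ge> 0"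
        and \<mu>: "\<mu> = (\<lambda>f. f s - \<alpha> * f t)"
        using mu[OF \<mu>M] by blast
      have "\<mu> f = 0" "\<mu> g = 0"
        using fg \<mu>M by (auto simp: annihilator_def)
      then have "f s = \<alpha> * f t" "g s = \<alpha> * g t"
        by (simp_all add: \<mu>)
      then show ?thesis
        using st F[OF st(3)] by (simp add: \<mu>)
    qed
    moreover have "(\<lambda>x\<in>topspace X. F (f x) (g x)) \<in> cont_fun X"
      using continuous_map_eq[OF cont] by (simp add: cont_fun_def)
    ultimately show ?thesis
      by (simp add: annihilator_def)
  qed
  have cont: "continuous_map X euclideanreal f" if "f \<in> annihilator X M" for f
    using that by (simp add: annihilator_def cont_fun_def)
  have zero: "(\<lambda>x\<in>topspace X. 0) \<in> annihilator X M"
  proof -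
    have "continuous_map X euclideanreal (\<lambda>x\<in>topspace X. 0)"
      by (rule continuous_map_eq[where f = "\<lambda>x. 0"]) auto
    moreover have "\<mu> (\<lambda>x\<in>topspace X. 0) = 0" if "\<mu> \<in> M" for \<mu>
      using mu[OF that] by auto
    ultimately show ?thesis
      by (simp add: annihilator_def cont_fun_def)
  qed
  have "sublattice X (annihilator X M)"
    unfolding sublattice_def linear_subspace_def
  proof (intro conjI ballI allI)
    show "annihilator X M \<subseteq> cont_fun X"
      by (auto simp: annihilator_def)
    show "(\<lambda>x\<in>topspace X. 0) \<in> annihilator X M"
      by (rule zero)
  next
    fix f g assume fg: "f \<in> annihilator X M" "g \<in> annihilator X M"
    note c = fg[THEN cont]
    show "(\<lambda>x\<in>topspace X. f x + g x) \<in> annihilator X M"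
      using closed[OF fg, of "(+)"] c by (simp add: distrib_left continuous_map_add)
    show "(\<lambda>x\<in>topspace X. max (f x) (g x)) \<in> annihilator X M"
      using closed[OF fg, of max] c
      by (simp add: max_mult_distrib_left continuous_map_real_max)
    show "(\<lambda>x\<in>topspace X. min (f x) (g x)) \<in> annihilator X M"
      using closed[OF fg, of min] c
      by (simp add: min_mult_distrib_left continuous_map_real_min)
  next
    fix c f assume f: "f \<in> annihilator X M"
    show "(\<lambda>x\<in>topspace X. c * f x) \<in> annihilator X M"
      using closed[OF f f, of "\<lambda>u v. c * u"] cont[OF f]
      by (simp add: continuous_map_real_mult)
  qed
  moreover have "closedin (compact_open_topology X) (annihilator X M)"
  proof -
    have "closedin (compact_open_topology X) {f \<in> topspace (compact_open_topology X). \<mu> f \<in> {0}}"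
      if \<mu>: "\<mu> \<in> M" for \<mu>
    proof (rule closedin_continuous_map_preimage[where Y = euclideanreal])
      obtain s t \<alpha> where st: "s \<in> topspace X" "t \<in> topspace X"
        and eq: "\<mu> = (\<lambda>f. delta s f - \<alpha> * delta t f)"
        using M \<mu> by blast
      show "continuous_map (compact_open_topology X) euclideanreal \<mu>"
        unfolding eq using st
        by (intro continuous_map_diff continuous_map_real_mult continuous_map_delta) auto
    qed simp
    then have "closedin (compact_open_topology X) (cont_fun X \<inter> (\<Inter>\<mu>\<in>M. {f \<in> cont_fun X. \<mu> f = 0}))"
      by (cases "M = {}")
         (auto simp: topspace_compact_open_topology[symmetric] intro!: closedin_Int closedin_INT)
    also have "cont_fun X \<inter> (\<Inter>\<mu>\<in>M. {f \<in> cont_fun X. \<mu> f = 0}) = annihilator X M"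
      by (auto simp: annihilator_def)
    finally show ?thesis .
  qed
  ultimately show ?thesis
    by (simp add: closed_sublattice_def)
qed

section \<open>Interpolation at two points\<close>

text \<open>The relations between values at \<open>s\<close> and \<open>t\<close> assumed to pass from \<open>L\<close> to \<open>f\<close> are
  \<open>h s = \<alpha> h t\<close> with \<open>\<alpha> \<ge> 0\<close>; those with \<open>\<alpha> = 0\<close> say that \<open>h\<close> vanishes at \<open>s\<close>.\<close>

lemma two_point_interpolation:
  assumes L: "sublattice X L"
    and f: "\<And>s t \<alpha>. \<lbrakk>s \<in> topspace X; t \<in> topspace X; \<alpha> \<ge> 0; \<forall>h\<in>L. h s = \<alpha> * h t\<rbrakk>
              \<Longrightarrow> f s = \<alpha> * f t"
    and s: "s \<in> topspace X" and t: "t \<in> topspace X"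
  shows "\<exists>g\<in>L. g s = f s \<and> g t = f t"
proof -
  note sl = sublatticeD[OF L]
  have comb: "(\<lambda>x\<in>topspace X. a * g x + b * h x) \<in> L" if "g \<in> L" "h \<in> L" for a b g h
  proof -
    have "(\<lambda>x\<in>topspace X. a * g x + b * h x) =
          (\<lambda>x\<in>topspace X. (\<lambda>x\<in>topspace X. a * g x) x + (\<lambda>x\<in>topspace X. b * h x) x)"
      by (rule restrict_ext) simp
    then show ?thesis
      using sl(3)[OF sl(4)[OF that(1), of a] sl(4)[OF that(2), of b]] by simp
  qed
  have scale: "\<exists>g\<in>L. g s = f s \<and> g t = f t" if "h \<in> L" "c * h s = f s" "c * h t = f t" for c h
    using sl(4)[OF that(1), of c] that s t by (intro bexI[of _ "\<lambda>x\<in>topspace X. c * h x"]) auto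
  show ?thesis
  proof (cases "\<forall>h\<in>L. h t = 0")
    case True
    then have ft: "f t = 0"
      using f[OF t t, of 0] by simp
    show ?thesis
    proof (cases "\<forall>h\<in>L. h s = 0")
      case True
      then have "f s = 0"
        using f[OF s s, of 0] by simp
      then show ?thesis
        using scale[OF sl(2), of 0] ft by simp
    next
      case False
      then obtain h where "h \<in> L" "h s \<noteq> 0" by blast
      then show ?thesis
        using scale[of h "f s / h s"] True ft by simp
    qed
  next
    case False
    then obtain g0 where g0: "g0 \<in> L" "g0 t \<noteq> 0" by blast
    \<comment> \<open>\<open>g\<close> is the absolute value of \<open>g0\<close>, which makes the ratio \<open>\<alpha>\<close> below nonnegative.\<close>
    define g where "g = (\<lambda>x\<in>topspace X. max (g0 x) ((\<lambda>x\<in>topspace X. (-1) * g0 x) x))"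
    have g: "g \<in> L" "g t > 0" "g s \<ge> 0"
      using sl(5)[OF g0(1) sl(4)[OF g0(1), of "-1"]] g0(2) s t by (auto simp: g_def)
    define \<alpha> where "\<alpha> = g s / g t"
    show ?thesis
    proof (cases "\<forall>h\<in>L. h s = \<alpha> * h t")
      case True
      then have "f s = \<alpha> * f t"
        using f[OF s t, of \<alpha>] g by (simp add: \<alpha>_def)
      then show ?thesis
        using scale[OF g(1), of "f t / g t"] g(2) by (simp add: \<alpha>_def)
    next
      case False
      then obtain h where h: "h \<in> L" "h s \<noteq> \<alpha> * h t" by blast
      define D where "D = g s * h t - g t * h s"
      have D: "D \<noteq> 0"
        using h(2) g(2) by (auto simp: D_def \<alpha>_def field_simps)
      \<comment> \<open>Cramer's rule for \<open>a (g s, g t) + b (h s, h t) = (f s, f t)\<close>.\<close>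
      define a b where "a = (f s * h t - f t * h s) / D" and "b = (g s * f t - g t * f s) / D"
      have "a * g s + b * h s = f s * (D / D)" "a * g t + b * h t = f t * (D / D)"
        unfolding a_def b_def times_divide_eq_left add_divide_distrib[symmetric] times_divide_eq_right
        by (rule arg_cong2[where f = "(/)"]; simp add: D_def algebra_simps)+
      then show ?thesis
        using comb[OF g(1) h(1), of a b] s t D
        by (intro bexI[of _ "\<lambda>x\<in>topspace X. a * g x + b * h x"]) auto
    qed
  qed
qed

section \<open>Uniform approximation on compact sets\<close>

text \<open>The compactness step of the Stone--Weierstrass argument.\<close>

lemma max_closed_above_on_compact:
  assumes G: "G \<noteq> {}" "G \<subseteq> cont_fun X"
    and max: "\<And>g h. g \<in> G \<Longrightarrow> h \<in> G \<Longrightarrow> (\<lambda>x\<in>topspace X. max (g x) (h x)) \<in> G"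
    and f: "continuous_map X euclideanreal f"
    and K: "compactin X K"
    and pt: "\<And>t. t \<in> K \<Longrightarrow> \<exists>g\<in>G. f t < g t"
  shows "\<exists>h\<in>G. \<forall>x\<in>K. f x < h x"
proof -
  define V where "V g = {x \<in> topspace X. f x < g x}" for g
  have "openin X U" if U: "U \<in> V ` G" for U
  proof -
    obtain g where "g \<in> G" "U = V g"
      using U by blast
    then have "continuous_map X euclideanreal (\<lambda>x. g x - f x)"
      using G(2) f by (auto simp: cont_fun_def intro!: continuous_map_diff)
    from openin_continuous_map_preimage[OF this, of "{0<..}"] show ?thesis
      using \<open>U = V g\<close> by (simp add: V_def)
  qed
  moreover have KX: "K \<subseteq> topspace X"
    using K compactin_subset_topspace by blast
  then have "K \<subseteq> \<Union>(V ` G)"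
    using pt by (auto simp: V_def)
  ultimately obtain \<F> where "finite \<F>" "\<F> \<subseteq> V ` G" "K \<subseteq> \<Union>\<F>"
    using K unfolding compactin_def by blast
  then obtain F where F: "finite F" "F \<subseteq> G" "K \<subseteq> \<Union>(V ` F)"
    by (metis finite_subset_image)
  have "\<exists>h\<in>G. \<forall>g\<in>F. \<forall>x\<in>topspace X. g x \<le> h x"
    using F(1,2)
  proof (induction F)
    case empty
    then show ?case using G(1) by blast
  next
    case (insert g F)
    then obtain h where "h \<in> G" "\<forall>k\<in>F. \<forall>x\<in>topspace X. k x \<le> h x" by auto
    then show ?case
      using max[of g h] insert.prems
      by (intro bexI[of _ "\<lambda>x\<in>topspace X. max (g x) (h x)"]) (auto simp: le_max_iff_disj)
  qed
  then obtain h where h: "h \<in> G" "\<forall>g\<in>F. \<forall>x\<in>topspace X. g x \<le> h x" by blast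
  have "f x < h x" if "x \<in> K" for x
  proof -
    obtain g where "g \<in> F" "x \<in> topspace X" "f x < g x"
      using F(3) \<open>x \<in> K\<close> by (auto simp: V_def)
    then show ?thesis
      using h(2) by force
  qed
  with h(1) show ?thesis by blast
qed

lemma uniform_approximation:
  assumes L: "sublattice X L"
    and f: "continuous_map X euclideanreal f"
    and K: "compactin X K"
    and e: "e > 0"
    and interp: "\<And>s t. s \<in> topspace X \<Longrightarrow> t \<in> topspace X \<Longrightarrow> \<exists>g\<in>L. g s = f s \<and> g t = f t"
  shows "\<exists>g\<in>L. \<forall>x\<in>K. \<bar>g x - f x\<bar> < e"
proof -
  note sl = sublatticeD[OF L]
  have KX: "K \<subseteq> topspace X"
    using K compactin_subset_topspace by blast
  \<comment> \<open>The value at \<open>s\<close> is kept while the maximum is taken, so that these functions, as \<open>s\<close> varies,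
      can be cut down to at most \<open>f + e\<close> in turn.\<close>
  have above: "\<exists>h\<in>L. h s = f s \<and> (\<forall>x\<in>K. f x - e < h x)" if s: "s \<in> topspace X" for s
  proof -
    have "\<exists>h\<in>{g\<in>L. g s = f s}. \<forall>x\<in>K. f x - e < h x"
    proof (rule max_closed_above_on_compact[OF _ _ _ _ K])
      show "{g\<in>L. g s = f s} \<noteq> {}"
        using interp[OF s s] by blast
      show "{g\<in>L. g s = f s} \<subseteq> cont_fun X"
        using sl(1) by blast
      show "(\<lambda>x\<in>topspace X. max (g x) (h x)) \<in> {g\<in>L. g s = f s}"
        if "g \<in> {g\<in>L. g s = f s}" "h \<in> {g\<in>L. g s = f s}" for g h
        using that sl(5) s by simp
      show "continuous_map X euclideanreal (\<lambda>x. f x - e)"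
        using f by (intro continuous_map_diff) auto
      show "\<exists>g\<in>{g\<in>L. g s = f s}. f t - e < g t" if "t \<in> K" for t
      proof -
        have "\<exists>g\<in>L. g s = f s \<and> g t = f t"
          using interp[OF s] that KX by blast
        then show ?thesis using e by force
      qed
    qed
    then show ?thesis by blast
  qed
  \<comment> \<open>Minima are replaced by maxima of negatives: \<open>G\<close> consists of the \<open>-h\<close> with \<open>h\<close> in \<open>L\<close> above
      \<open>f - e\<close> on \<open>K\<close>, and a member of \<open>G\<close> above \<open>- f - e\<close> is sought.\<close>
  define G where "G = {g\<in>L. \<forall>x\<in>K. g x < e - f x}"
  have neg: "\<exists>g\<in>G. \<forall>x\<in>K. g x = - h x" if "h \<in> L" "\<forall>x\<in>K. f x - e < h x" for h
    using that sl(4)[of h "-1"] KX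
    by (intro bexI[of _ "\<lambda>x\<in>topspace X. -1 * h x"]) (force simp: G_def)+
  have "\<exists>h\<in>G. \<forall>x\<in>K. - f x - e < h x"
  proof (rule max_closed_above_on_compact[OF _ _ _ _ K])
    show "G \<noteq> {}"
    proof (cases "K = {}")
      case True
      then show ?thesis using sl(2) by (auto simp: G_def)
    next
      case False
      then obtain s where "s \<in> topspace X" using KX by blast
      then show ?thesis using above neg by blast
    qed
    show "G \<subseteq> cont_fun X"
      using sl(1) by (auto simp: G_def)
    show "(\<lambda>x\<in>topspace X. max (g x) (h x)) \<in> G" if "g \<in> G" "h \<in> G" for g h
      using that sl(5) KX by (auto simp: G_def)
    show "continuous_map X euclideanreal (\<lambda>x. - f x - e)"
      using f by (intro continuous_map_diff continuous_map_minus) auto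
    show "\<exists>g\<in>G. - f t - e < g t" if t: "t \<in> K" for t
    proof -
      obtain h where h: "h \<in> L" "h t = f t" "\<forall>x\<in>K. f x - e < h x"
        using above[of t] t KX by blast
      then obtain g where "g \<in> G" "\<forall>x\<in>K. g x = - h x"
        using neg by blast
      then show ?thesis
        using h(2) t e by force
    qed
  qed
  then obtain h where h: "h \<in> G" "\<forall>x\<in>K. - f x - e < h x" by blast
  then have hL: "h \<in> L" and "\<forall>x\<in>K. h x < e - f x"
    by (auto simp: G_def)
  with h(2) have "\<bar>- 1 * h x - f x\<bar> < e" if "x \<in> K" for x
    using that by (force simp: abs_less_iff)
  then show ?thesis
    using sl(4)[OF hL, of "-1"] KX by (intro bexI[of _ "\<lambda>x\<in>topspace X. -1 * h x"]) auto
qed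

lemma closed_sublattice_contains_interpolable:
  assumes L: "closed_sublattice X L"
    and f: "f \<in> cont_fun X"
    and interp: "\<And>s t. s \<in> topspace X \<Longrightarrow> t \<in> topspace X \<Longrightarrow> \<exists>g\<in>L. g s = f s \<and> g t = f t"
  shows "f \<in> L"
proof (rule ccontr)
  assume "f \<notin> L"
  have sub: "sublattice X L" and "closedin (compact_open_topology X) L"
    using L by (auto simp: closed_sublattice_def)
  then have "openin (compact_open_topology X) (cont_fun X - L)"
    by (simp add: closedin_def topspace_compact_open_topology)
  moreover have "f \<in> cont_fun X - L"
    using f \<open>f \<notin> L\<close> by blast
  ultimately obtain K e where K: "compactin X K" "e > 0"
    and nbhd: "\<forall>g\<in>cont_fun X. (\<forall>x\<in>K. \<bar>g x - f x\<bar> < e) \<longrightarrow> g \<in> cont_fun X - L"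
    using compact_open_uniform_nbhd by blast
  have "continuous_map X euclideanreal f"
    using f by (simp add: cont_fun_def)
  then obtain g where "g \<in> L" "\<forall>x\<in>K. \<bar>g x - f x\<bar> < e"
    using uniform_approximation[OF sub _ K interp] by blast
  with nbhd sublatticeD(1)[OF sub] show False by blast
qed

section \<open>Characterisation of closed sublattices\<close>

theorem corollary2p2:
  fixes X :: "'a topology" and L :: "('a \<Rightarrow> real) set"
  assumes "completely_regular_space X" and "Hausdorff_space X"
    and "L \<subseteq> cont_fun X"
  shows "closed_sublattice X L \<longleftrightarrow>
    (\<exists>M. M \<subseteq> {(\<lambda>f. delta s f - \<alpha> * delta t f) | s t \<alpha>.
                s \<in> topspace X \<and> t \<in> topspace X \<and> \<alpha> \<ge> 0}
       \<and> L = annihilator X M)"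
    (is "_ \<longleftrightarrow> (\<exists>M. M \<subseteq> ?D \<and> _)")
proof
  assume L: "closed_sublattice X L"
  define M where "M = {\<mu> \<in> ?D. \<forall>h\<in>L. \<mu> h = 0}"
  have "f \<in> L" if f: "f \<in> annihilator X M" for f
  proof (rule closed_sublattice_contains_interpolable[OF L])
    show "f \<in> cont_fun X"
      using f by (simp add: annihilator_def)
    have rel: "f s = \<alpha> * f t"
      if "s \<in> topspace X" "t \<in> topspace X" "\<alpha> \<ge> 0" "\<forall>h\<in>L. h s = \<alpha> * h t" for s t \<alpha>
    proof -
      have "(\<lambda>f. delta s f - \<alpha> * delta t f) \<in> M"
        using that by (auto simp: M_def delta_def)
      then have "delta s f - \<alpha> * delta t f = 0"
        using f by (auto simp: annihilator_def)
      then show ?thesis by (simp add: delta_def)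
    qed
    have "sublattice X L"
      using L by (simp add: closed_sublattice_def)
    then show "\<exists>g\<in>L. g s = f s \<and> g t = f t" if "s \<in> topspace X" "t \<in> topspace X" for s t
      by (rule two_point_interpolation[OF _ rel that])
  qed
  moreover have "L \<subseteq> annihilator X M"
    using assms(3) by (auto simp: annihilator_def M_def)
  moreover have "M \<subseteq> ?D"
    by (auto simp: M_def)
  ultimately show "\<exists>M. M \<subseteq> ?D \<and> L = annihilator X M"
    by blast
next
  assume "\<exists>M. M \<subseteq> ?D \<and> L = annihilator X M"
  then show "closed_sublattice X L"
    using closed_sublattice_annihilator by blast
qed

end
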